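(* For every positive integer $k\in\mathbb{N}$, the sentence $\nu_k$ holds in $PA^-$, i.e. $\nu_k$ is true in every model of $PA^-$ (equivalently, it is provable from the axioms of $PA^-$), where $\nu_k$ is the following first-order sentence: $$(\forall m)(\forall n)(\forall p)\ \Big[\ (m>0\wedge n>0)\rightarrow \sum_{i=0}^{k}\ \prod_{0\le j\le k,\ j\neq i}(m+\overline{j}\,n)\ \neq\ p\prod_{0\le j\le k}(m+\overline{j}\,n)\ \Big].$$
   Context: $PA^-$ is the first-order theory with equality in the language with binary operations $+,\cdot$, constants $0,1$ and binary relation $<$ (with $x>y$ meaning $y<x$), axiomatized by the universal closures of: A1 $(x+y)+z=x+(y+z)$; A2 $x+y=y+x$; A3 $(x\cdot y)\cdot z=x\cdot(y\cdot z)$; A4 $x\cdot y=y\cdot x$; A5 $x\cdot(y+z)=x\cdot y+x\cdot z$; A6 $x+0=x\wedge x\cdot 0=0$; A7 $x\cdot 1=x$; A8 $(x<y\wedge y<z)\rightarrow x<z$; A9 $\neg\, x<x$; A10 $x<y\vee x=y\vee y<x$; A11 $x<y\rightarrow x+z<y+z$; A12 $(0<z\wedge x<y)\rightarrow x\cdot z<y\cdot z$; A13 $(\forall x)(\forall y)(\exists z)\ (x<y\rightarrow x+z=y)$; A14 $0<1\wedge(x>0\rightarrow(x>1\vee x=1))$; A15 $x>0\vee x=0$. There is no induction axiom. For $u\in\mathbb{N}$, the numeral $\overline{u}$ is the term $((\ldots((1+1)+1)+\ldots)+1)$ with $u$ occurrences of $1$ (and $\overline{0}$ is $0$). The integer $k$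 is an external (standard) positive integer, so the sums and products indexed by $0,\dots,k$ are finite expressions of the language; all quantified variables range over the universe of the model. *)

theory Defs
  imports Main
begin

section \<open>First-order logic over the language of ordered semirings\<close>

datatype tm =
    Var nat
  | Zero ("\<^bold>0")
  | One ("\<^bold>1")
  | Add tm tm (infixl "\<^bold>+" 65)
  | Mul tm tm (infixl "\<^bold>*" 70)

datatype fm =
    Eq tm tm (infix "\<^bold>=" 50)
  | Less tm tm (infix "\<^bold><" 50)
  | Neg fm ("\<^bold>\<not> _" [40] 40)
  | Conj fm fm (infixr "\<^bold>\<and>" 35)
  | Disj fm fm (infixr "\<^bold>\<or>" 30)
  | Impl fm fm (infixr "\<^bold>\<longrightarrow>" 25)
  | All nat fm ("(3\<^bold>\<forall>_./ _)" [0, 10] 10)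
  | Exi nat fm ("(3\<^bold>\<exists>_./ _)" [0, 10] 10)

abbreviation (input) Greater :: "tm \<Rightarrow> tm \<Rightarrow> fm" (infix "\<^bold>>" 50) where
  "s \<^bold>> t \<equiv> t \<^bold>< s"

abbreviation (input) Neq :: "tm \<Rightarrow> tm \<Rightarrow> fm" (infix "\<^bold>\<noteq>" 50) where
  "s \<^bold>\<noteq> t \<equiv> \<^bold>\<not> (s \<^bold>= t)"

text \<open>The universe of a structure is the whole type \<open>'a\<close>, which is nonempty;
  equality is interpreted as equality on \<open>'a\<close>.\<close>

record 'a interp =
  zero_of :: 'a
  one_of :: 'a
  add_of :: "'a \<Rightarrow> 'a \<Rightarrow> 'a"
  mul_of :: "'a \<Rightarrow> 'a \<Rightarrow> 'a"
  less_of :: "'a \<Rightarrow> 'a \<Rightarrow> bool"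

primrec eval_tm :: "'a interp \<Rightarrow> (nat \<Rightarrow> 'a) \<Rightarrow> tm \<Rightarrow> 'a" where
  "eval_tm M e (Var v) = e v"
| "eval_tm M e \<^bold>0 = zero_of M"
| "eval_tm M e \<^bold>1 = one_of M"
| "eval_tm M e (s \<^bold>+ t) = add_of M (eval_tm M e s) (eval_tm M e t)"
| "eval_tm M e (s \<^bold>* t) = mul_of M (eval_tm M e s) (eval_tm M e t)"

primrec sat :: "'a interp \<Rightarrow> (nat \<Rightarrow> 'a) \<Rightarrow> fm \<Rightarrow> bool" where
  "sat M e (s \<^bold>= t) \<longleftrightarrow> eval_tm M e s = eval_tm M e t"
| "sat M e (s \<^bold>< t) \<longleftrightarrow> less_of M (eval_tm M e s) (eval_tm M e t)"
| "sat M e (\<^bold>\<not> A) \<longleftrightarrow> \<not> sat M e A"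
| "sat M e (A \<^bold>\<and> B) \<longleftrightarrow> sat M e A \<and> sat M e B"
| "sat M e (A \<^bold>\<or> B) \<longleftrightarrow> sat M e A \<or> sat M e B"
| "sat M e (A \<^bold>\<longrightarrow> B) \<longleftrightarrow> (sat M e A \<longrightarrow> sat M e B)"
| "sat M e (\<^bold>\<forall>v. A) \<longleftrightarrow> (\<forall>a. sat M (e(v := a)) A)"
| "sat M e (\<^bold>\<exists>v. A) \<longleftrightarrow> (\<exists>a. sat M (e(v := a)) A)"

text \<open>For a sentence the assignment is irrelevant, so quantifying over it is harmless.\<close>

definition holds_in :: "'a interp \<Rightarrow> fm \<Rightarrow> bool" (infix "\<Turnstile>" 50) where
  "M \<Turnstile> A \<longleftrightarrow> (\<forall>e. sat M e A)"

definition is_model :: "'a interp \<Rightarrow> fm set \<Rightarrow> bool" where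
  "is_model M T \<longleftrightarrow> (\<forall>A\<in>T. M \<Turnstile> A)"


section \<open>The theory \<open>PA\<^sup>-\<close>\<close>

definition PA_minus :: "fm set" where
  "PA_minus = (let x = Var 0; y = Var 1; z = Var 2 in
    { \<^bold>\<forall>0. \<^bold>\<forall>1. \<^bold>\<forall>2. (x \<^bold>+ y) \<^bold>+ z \<^bold>= x \<^bold>+ (y \<^bold>+ z),
      \<^bold>\<forall>0. \<^bold>\<forall>1. x \<^bold>+ y \<^bold>= y \<^bold>+ x,
      \<^bold>\<forall>0. \<^bold>\<forall>1. \<^bold>\<forall>2. (x \<^bold>* y) \<^bold>* z \<^bold>= x \<^bold>* (y \<^bold>* z),
      \<^bold>\<forall>0. \<^bold>\<forall>1. x \<^bold>* y \<^bold>= y \<^bold>* x,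
      \<^bold>\<forall>0. \<^bold>\<forall>1. \<^bold>\<forall>2. x \<^bold>* (y \<^bold>+ z) \<^bold>= x \<^bold>* y \<^bold>+ x \<^bold>* z,
      \<^bold>\<forall>0. x \<^bold>+ \<^bold>0 \<^bold>= x \<^bold>\<and> x \<^bold>* \<^bold>0 \<^bold>= \<^bold>0,
      \<^bold>\<forall>0. x \<^bold>* \<^bold>1 \<^bold>= x,
      \<^bold>\<forall>0. \<^bold>\<forall>1. \<^bold>\<forall>2. (x \<^bold>< y \<^bold>\<and> y \<^bold>< z) \<^bold>\<longrightarrow> x \<^bold>< z,
      \<^bold>\<forall>0. \<^bold>\<not> (x \<^bold>< x),
      \<^bold>\<forall>0. \<^bold>\<forall>1. x \<^bold>< y \<^bold>\<or> x \<^bold>= y \<^bold>\<or> y \<^bold>< x,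
      \<^bold>\<forall>0. \<^bold>\<forall>1. \<^bold>\<forall>2. x \<^bold>< y \<^bold>\<longrightarrow> x \<^bold>+ z \<^bold>< y \<^bold>+ z,
      \<^bold>\<forall>0. \<^bold>\<forall>1. \<^bold>\<forall>2. (\<^bold>0 \<^bold>< z \<^bold>\<and> x \<^bold>< y) \<^bold>\<longrightarrow> x \<^bold>* z \<^bold>< y \<^bold>* z,
      \<^bold>\<forall>0. \<^bold>\<forall>1. \<^bold>\<exists>2. x \<^bold>< y \<^bold>\<longrightarrow> x \<^bold>+ z \<^bold>= y,
      \<^bold>\<forall>0. \<^bold>0 \<^bold>< \<^bold>1 \<^bold>\<and> (x \<^bold>> \<^bold>0 \<^bold>\<longrightarrow> (x \<^bold>> \<^bold>1 \<^bold>\<or> x \<^bold>= \<^bold>1)),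
      \<^bold>\<forall>0. x \<^bold>> \<^bold>0 \<^bold>\<or> x \<^bold>= \<^bold>0 })"


section \<open>The sentences \<open>\<nu>\<^sub>k\<close>\<close>

fun numeral_tm :: "nat \<Rightarrow> tm" where
  "numeral_tm 0 = \<^bold>0"
| "numeral_tm (Suc 0) = \<^bold>1"
| "numeral_tm (Suc (Suc u)) = numeral_tm (Suc u) \<^bold>+ \<^bold>1"

text \<open>Finite sums and products of terms, bracketed to the left. The empty cases do not
  occur in \<open>\<nu>\<^sub>k\<close> for \<open>k > 0\<close>.\<close>

fun sum_tm :: "tm list \<Rightarrow> tm" where
  "sum_tm [] = \<^bold>0"
| "sum_tm (t # ts) = foldl Add t ts"

fun prod_tm :: "tm list \<Rightarrow> tm" where
  "prod_tm [] = \<^bold>1"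
| "prod_tm (t # ts) = foldl Mul t ts"

definition nu :: "nat \<Rightarrow> fm" where
  "nu k = (let m = Var 0; n = Var 1; p = Var 2; f = (\<lambda>j. m \<^bold>+ numeral_tm j \<^bold>* n) in
    \<^bold>\<forall>0. \<^bold>\<forall>1. \<^bold>\<forall>2. (m \<^bold>> \<^bold>0 \<^bold>\<and> n \<^bold>> \<^bold>0) \<^bold>\<longrightarrow>
      sum_tm [prod_tm [f j. j \<leftarrow> [0..<Suc k], j \<noteq> i]. i \<leftarrow> [0..<Suc k]]
        \<^bold>\<noteq> p \<^bold>* prod_tm [f j. j \<leftarrow> [0..<Suc k]])"

end

theory Submission
  imports Defs Complex_Main "HOL-Computational_Algebra.Primes"
begin

text \<open>
  Write \<open>u\<^sub>j = m + j n\<close>; the equation says that \<open>\<Sum> 1 / u\<^sub>j = p\<close>. Comparing sizes in a discretely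
  ordered semiring gives \<open>m, p \<le> k + 1\<close> and \<open>n \<le> k m\<close>, and an element below a standard one is
  standard, so only the case of natural numbers \<open>m = a\<close>, \<open>n = d\<close> is left, where one may assume
  \<open>gcd a d = 1\<close>.

  There, a prime power dividing one \<open>u\<^sub>i\<close> divides another \<open>u\<^sub>j\<close> as well (else \<open>1 / u\<^sub>i\<close> is the only
  summand with its pole), hence divides \<open>j - i\<close>; so all \<open>u\<^sub>j\<close> divide \<open>L k = lcm (1, \<dots>, k)\<close>. On the
  other hand \<open>\<Prod> u\<^sub>j\<close> divides \<open>k! L k\<close>, whence \<open>d ^ k \<le> L k \<le> 4 ^ (k - 1)\<close> and \<open>d < 4\<close>. If \<open>d\<close> is odd,
  the maximal power of \<open>2\<close> dividing some \<open>u\<^sub>i\<close> divides no other one. If \<open>d = 2\<close>, then \<open>a \<le> k + 1\<close>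
  shows that \<open>L (2 k + 1)\<close> divides \<open>2 L k\<close>, against \<open>L (2 k + 1) \<ge> 4 ^ k\<close>.
\<close>

section \<open>Least common multiples of initial segments\<close>

text \<open>Multiplicities are compared prime by prime; this reduces the lcm divisibilities below to
  prime powers.\<close>

lemma dvd_if_prime_powers_dvd:
  fixes m n :: nat
  assumes "m > 0" and "\<And>q e. prime q \<Longrightarrow> 0 < e \<Longrightarrow> q ^ e dvd m \<Longrightarrow> q ^ e dvd n"
  shows "m dvd n"
proof (cases "n = 0")
  case False
  show ?thesis
  proof (rule multiplicity_le_imp_dvd)
    fix q :: nat
    assume q: "prime q"
    have "q ^ multiplicity q m dvd n"
    proof (cases "multiplicity q m = 0")
      case False
      then show ?thesis
        using assms(2)[OF q] by (simp add: multiplicity_dvd)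
    qed simp
    with False q show "multiplicity q m \<le> multiplicity q n"
      by (intro multiplicity_geI) auto
  qed (use assms(1) in simp)
qed simp

text \<open>In \<open>i * (q ^ e choose i) = q ^ e * ((q ^ e - 1) choose (i - 1))\<close> a binomial
  prime to \<open>q\<close> would force \<open>q ^ e\<close> to divide the smaller number
  \<open>i\<close>.\<close>

lemma prime_dvd_prime_power_choose:
  fixes q :: nat
  assumes "prime q" "0 < i" "i < q ^ e"
  shows "q dvd (q ^ e choose i)"
proof (rule ccontr)
  assume "\<not> q dvd (q ^ e choose i)"
  then have cop: "coprime (q ^ e) (q ^ e choose i)"
    using assms(1) by (metis coprime_power_left_iff prime_imp_coprime)
  have "i * (q ^ e choose i) = q ^ e * ((q ^ e - 1) choose (i - 1))"
    using assms by (simp add: times_binomial_minus1_eq)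
  then have "q ^ e dvd i * (q ^ e choose i)"
    by simp
  then have "q ^ e dvd i"
    using cop by (simp add: coprime_dvd_mult_left_iff)
  with assms show False
    by (simp add: nat_dvd_not_less)
qed

text \<open>Vandermonde for \<open>c = q ^ e + (c - q ^ e)\<close>: the summand \<open>i = 0\<close>
  vanishes since \<open>c - q ^ e < b\<close>, and in the others \<open>0 < i < q ^ e\<close>, so
  \<open>q\<close> divides the first factor.\<close>

lemma prime_dvd_choose_if_power:
  fixes q :: nat
  assumes "prime q" "b < q ^ e" "c - b < q ^ e" "q ^ e \<le> c"
  shows "q dvd (c choose b)"
proof -
  have "c choose b = (\<Sum>i\<le>b. (q ^ e choose i) * ((c - q ^ e) choose (b - i)))"
    using vandermonde[of "q ^ e" "c - q ^ e" b] assms(4) by simp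
  moreover have "q dvd (q ^ e choose i) * ((c - q ^ e) choose (b - i))" if "i \<le> b" for i
  proof (cases "i = 0")
    case True
    then show ?thesis
      using assms by (simp add: binomial_eq_0)
  next
    case False
    then show ?thesis
      using that assms by (intro dvd_mult2 prime_dvd_prime_power_choose) auto
  qed
  ultimately show ?thesis
    by (metis (no_types, lifting) atMost_iff dvd_sum)
qed

text \<open>A prime power \<open>q ^ e \<le> c\<close> that exceeds \<open>l\<close> exceeds it by
  one factor \<open>q\<close> only, as \<open>q ^ (e - 1) \<le> c / 2 \<le> l\<close>; the binomial
  supplies that factor.\<close>

lemma Lcm_upto_dvd_mult_choose:
  fixes b l c :: nat
  assumes "b \<le> l" "c - b \<le> l" "c \<le> 2 * l"
  shows "Lcm {1..c} dvd Lcm {1..l} * (c choose b)"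
proof (rule Lcm_least)
  fix m
  assume m: "m \<in> {1..c}"
  show "m dvd Lcm {1..l} * (c choose b)"
  proof (rule dvd_if_prime_powers_dvd)
    fix q e :: nat
    assume q: "prime q" and e: "0 < e" and dvd: "q ^ e dvd m"
    have le: "q ^ e \<le> c"
      using m dvd dvd_imp_le[of "q ^ e" m] by simp
    have pos: "q ^ i > 0" for i
      using q prime_gt_0_nat by simp
    show "q ^ e dvd Lcm {1..l} * (c choose b)"
    proof (cases "q ^ e \<le> l")
      case True
      then show ?thesis
        using pos[of e] by (intro dvd_mult2 dvd_Lcm) (simp add: Suc_le_eq)
    next
      case False
      obtain e' where e': "e = Suc e'"
        using e gr0_implies_Suc by blast
      have "2 * q ^ e' \<le> q ^ e"
        using prime_ge_2_nat[OF q] by (simp add: e')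
      then have "q ^ e' \<le> l"
        using le assms(3) by linarith
      then have "q ^ e' dvd Lcm {1..l}"
        using pos[of e'] by (intro dvd_Lcm) (simp add: Suc_le_eq)
      moreover have "q dvd (c choose b)"
        using False assms le by (intro prime_dvd_choose_if_power[OF q, of b e]) auto
      ultimately show ?thesis
        unfolding e' power_Suc2 by (rule mult_dvd_mono)
    qed
  qed (use m in simp)
qed

lemma Lcm_upto_pos: "Lcm {1..n::nat} > 0"
  using Lcm_0_iff_nat[of "{1..n}"] by (metis Lcm_0_iff atLeastAtMost_iff finite_atLeastAtMost gr0I not_one_le_zero)

text \<open>The two equal middle entries of row \<open>2 * n + 1\<close> together are at most the
  row sum \<open>2 * 4 ^ n\<close>.\<close>

lemma middle_binomial_le: "(2 * n + 1) choose n \<le> 4 ^ n"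
proof -
  have "(2 * n + 1) choose (n + 1) = (2 * n + 1) choose n"
    using binomial_symmetric[of n "2 * n + 1"] by simp
  then have "2 * ((2 * n + 1) choose n) = (\<Sum>i\<in>{n, n + 1}. (2 * n + 1) choose i)"
    by simp
  also have "\<dots> \<le> (\<Sum>i\<le>2 * n + 1. (2 * n + 1) choose i)"
    by (intro sum_mono2) auto
  also have "\<dots> = 2 * 4 ^ n"
    unfolding choose_row_sum by (simp add: power_mult)
  finally show ?thesis
    by simp
qed

text \<open>Strong induction by halving: going from \<open>l\<close>, about \<open>n / 2\<close>, up
  to \<open>n\<close> costs at most a middle binomial, which is bounded by
  \<open>4 ^ (n - l)\<close>.\<close>

lemma Lcm_upto_le: "n > 0 \<Longrightarrow> Lcm {1..n::nat} \<le> 4 ^ (n - 1)"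
proof (induction n rule: less_induct)
  case (less n)
  have bound: "Lcm {1..n} \<le> 4 ^ (n - 1)"
    if "b \<le> l" "n - b \<le> l" "n \<le> 2 * l" "0 < l" "l < n" "b \<le> n"
      "n choose b \<le> 4 ^ (n - l)" for b l
  proof -
    have "Lcm {1..n} \<le> Lcm {1..l} * (n choose b)"
      using that Lcm_upto_dvd_mult_choose[of b l n] Lcm_upto_pos[of l]
      by (intro dvd_imp_le) auto
    also have "\<dots> \<le> 4 ^ (l - 1) * 4 ^ (n - l)"
      using that less.IH[of l] by (intro mult_mono) auto
    also have "\<dots> = 4 ^ (n - 1)"
      using that by (simp flip: power_add)
    finally show ?thesis .
  qed
  consider "n = 1" | m where "n = 2 * m" "m > 0" | m where "n = 2 * m + 1" "m > 0"
    using less.prems by (metis One_nat_def add_0 evenE gr0I mult_0_right nat_less_le oddE)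
  then show ?case
  proof cases
    case 2
    then show ?thesis
      using binomial_le_pow2[of "2 * m" m] by (intro bound[of m m]) (auto simp: power_mult)
  next
    case 3
    then show ?thesis
      using middle_binomial_le[of m] by (intro bound[of m "m + 1"]) auto
  qed auto
qed

section \<open>Reciprocals in arithmetic progression\<close>

text \<open>The quotients \<open>X\<close> and \<open>Y\<close> for the progressions without the last and without the first
  term differ by the quotient for the full one.\<close>

lemma prod_AP_dvd:
  fixes a d L :: int
  assumes "\<And>j. j \<le> k \<Longrightarrow> a + int j * d dvd L"
  shows "(\<Prod>j\<le>k. a + int j * d) dvd L * fact k * d ^ k"
  using assms
proof (induction k arbitrary: a)
  case (Suc k)
  define A where "A = (\<Prod>j\<le>k. a + int j * d)"
  define B where "B = (\<Prod>j\<le>k. (a + d) + int j * d)"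
  define P where "P = (\<Prod>j\<le>Suc k. a + int j * d)"
  have PA: "P = A * (a + int (Suc k) * d)"
    by (simp add: P_def A_def)
  have PB: "P = a * B"
    unfolding P_def B_def by (subst prod.atMost_Suc_shift) (simp add: algebra_simps)
  have "A dvd L * fact k * d ^ k"
    unfolding A_def using Suc.prems by (intro Suc.IH) auto
  then obtain X where X: "L * fact k * d ^ k = A * X"
    by (elim dvdE)
  have "B dvd L * fact k * d ^ k"
    unfolding B_def
  proof (rule Suc.IH)
    show "a + d + int j * d dvd L" if "j \<le> k" for j
      using Suc.prems[of "Suc j"] that by (simp add: algebra_simps)
  qed
  then obtain Y where Y: "L * fact k * d ^ k = B * Y"
    by (elim dvdE)
  have "L * fact (Suc k) * d ^ Suc k
      = (L * fact k * d ^ k) * (a + int (Suc k) * d) - (L * fact k * d ^ k) * a"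
    by (simp add: algebra_simps)
  also have "\<dots> = A * X * (a + int (Suc k) * d) - B * Y * a"
    by (subst X, subst Y) (rule refl)
  also have "A * X * (a + int (Suc k) * d) = P * X"
    by (simp add: PA)
  also have "B * Y * a = P * Y"
    by (simp add: PB)
  also have "P * X - P * Y = P * (X - Y)"
    by (simp add: right_diff_distrib)
  finally show ?case
    unfolding P_def by simp
qed simp

text \<open>All terms are prime to \<open>d\<close>, so the factor \<open>d ^ k\<close> in
  \<open>prod_AP_dvd\<close> cancels. The integers enter only because that lemma subtracts
  quotients.\<close>

lemma prod_AP_dvd_coprime:
  fixes a d L :: nat
  assumes "coprime a d" and "\<And>j. j \<le> k \<Longrightarrow> a + j * d dvd L"
  shows "(\<Prod>j\<le>k. a + j * d) dvd L * fact k"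
proof -
  have "(\<Prod>j\<le>k. int a + int j * int d) dvd int L * fact k * int d ^ k"
    using assms(2) by (intro prod_AP_dvd) (metis of_nat_add of_nat_dvd_iff of_nat_mult)
  also have "(\<Prod>j\<le>k. int a + int j * int d) = int (\<Prod>j\<le>k. a + j * d)"
    by simp
  also have "int L * fact k * int d ^ k = int (L * fact k * d ^ k)"
    by simp
  finally have "(\<Prod>j\<le>k. a + j * d) dvd L * fact k * d ^ k"
    by (simp only: of_nat_dvd_iff)
  moreover have "coprime (a + j * d) d" for j
    using assms(1) by (metis add.commute coprime_iff_gcd_eq_1 gcd.commute gcd_add_mult mult.commute)
  then have "coprime (\<Prod>j\<le>k. a + j * d) (d ^ k)"
    by (simp add: prod_coprime_left)
  ultimately show ?thesis
    by (simp add: coprime_dvd_mult_left_iff)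
qed

lemma prod_AP_ge: "a * (d ^ k * fact k) \<le> (\<Prod>j\<le>k. a + j * d :: nat)"
proof (induction k)
  case (Suc k)
  have "a * (d ^ Suc k * fact (Suc k)) = a * (d ^ k * fact k) * (Suc k * d)"
    by (simp add: algebra_simps)
  also have "\<dots> \<le> (\<Prod>j\<le>k. a + j * d) * (a + Suc k * d)"
    using Suc.IH by (intro mult_mono) auto
  finally show ?case
    by simp
qed simp

text \<open>The product of \<open>k + 1, ..., 2 * k + 1\<close> is
  \<open>(2 * k + 1) * ((2 * k) choose k) * fact k\<close> and divides the lcm times
  \<open>fact k\<close>; the central binomial is at least \<open>4 ^ k / (2 * k)\<close>.\<close>

lemma Lcm_upto_ge:
  assumes "k > 0"
  shows "4 ^ k \<le> Lcm {1..2 * k + 1 :: nat}"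
proof -
  \<comment> \<open>The factor \<open>1\<close> keeps the shape of a progression with difference
    1.\<close>
  define P where "P = (\<Prod>j\<le>k. (k + 1) + j * 1)"
  have "fact (k + n + 1) = fact k * (\<Prod>j\<le>n. (k + 1) + j * 1 :: nat)" for n
    by (induction n) (simp_all add: algebra_simps)
  then have "fact (2 * k + 1) = fact k * P"
    unfolding P_def by (metis mult_2)
  moreover have "fact (2 * k) = fact k * fact k * ((2 * k) choose k)"
    using binomial_fact_lemma[of k "2 * k"] by (simp add: mult_2)
  ultimately have "fact k * P = fact k * ((2 * k + 1) * ((2 * k) choose k) * fact k)"
    by (simp add: algebra_simps)
  then have P: "P = (2 * k + 1) * ((2 * k) choose k) * fact k"
    by (simp only: mult_cancel1 fact_nonzero simp_thms)
  have "P dvd Lcm {1..2 * k + 1} * fact k"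
    unfolding P_def by (intro prod_AP_dvd_coprime dvd_Lcm) auto
  then have "(2 * k + 1) * ((2 * k) choose k) dvd Lcm {1..2 * k + 1}"
    unfolding P by simp
  then have le: "(2 * k + 1) * ((2 * k) choose k) \<le> Lcm {1..2 * k + 1}"
    using Lcm_upto_pos by (rule dvd_imp_le)
  have "4 ^ k / (2 * real k) \<le> real ((2 * k) choose k)"
    using central_binomial_lower_bound[OF assms] .
  then have "4 ^ k \<le> real (2 * k) * real ((2 * k) choose k)"
    using assms by (simp add: field_simps)
  then have "4 ^ k \<le> 2 * k * ((2 * k) choose k)"
    by (metis of_nat_le_iff of_nat_mult of_nat_numeral of_nat_power)
  with le show ?thesis
    by simp
qed

section \<open>Prime powers in the denominators of an integral sum\<close>

lemma prime_power_dvd_other_denominator: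
  fixes u :: "'i \<Rightarrow> nat"
  assumes fin: "finite I" and pos: "\<And>i. i \<in> I \<Longrightarrow> u i > 0"
    and int: "(\<Sum>i\<in>I. 1 / real (u i)) \<in> \<int>"
    and q: "prime q" and e: "0 < e" and i: "i \<in> I" and dvd: "q ^ e dvd u i"
  shows "\<exists>j\<in>I. j \<noteq> i \<and> q ^ e dvd u j"
proof (rule ccontr)
  assume neg: "\<not> ?thesis"
  have nu: "\<not> is_unit q"
    using q not_prime_unit by blast
  define v where "v = (\<lambda>j. multiplicity q (u j))"
  have "\<exists>w. u j = q ^ v j * w \<and> \<not> q dvd w" if "j \<in> I" for j
    using multiplicity_decompose'[of "u j" q] pos[OF that] nu unfolding v_def by blast
  then obtain w where w: "\<And>j. j \<in> I \<Longrightarrow> u j = q ^ v j * w j" "\<And>j. j \<in> I \<Longrightarrow> \<not> q dvd w j"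
    by metis
  define f where "f = v i - 1"
  have "e \<le> v i"
    unfolding v_def using dvd pos[OF i] nu by (intro multiplicity_geI) auto
  then have vi: "v i = Suc f"
    using e by (simp add: f_def)
  \<comment> \<open>\<open>N\<close> is a common multiple of all the other denominators, but has one
    factor \<open>q\<close> too few to be a multiple of \<open>u i\<close>; yet \<open>N\<close>
    times the integral sum is an integer.\<close>
  define N where "N = q ^ f * (\<Prod>j\<in>I. w j)"
  have "u j dvd N" if "j \<in> I - {i}" for j
  proof -
    have "\<not> q ^ e dvd u j"
      using neg that by auto
    then have "v j < e"
      unfolding v_def by (metis multiplicity_dvd' not_le)
    then have "q ^ v j dvd q ^ f"
      using \<open>e \<le> v i\<close> vi by (intro le_imp_power_dvd) auto
    moreover have "w j dvd (\<Prod>j\<in>I. w j)"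
      using that fin by auto
    ultimately show ?thesis
      using w(1)[of j] that by (simp add: N_def mult_dvd_mono)
  qed
  then have "real N / real (u j) \<in> \<int>" if "j \<in> I - {i}" for j
    using that by (metis Ints_of_nat real_of_nat_div)
  then have others: "(\<Sum>j\<in>I - {i}. real N / real (u j)) \<in> \<int>"
    by (rule Ints_sum)
  have "real N * (\<Sum>j\<in>I. 1 / real (u j)) \<in> \<int>"
    using int by (intro Ints_mult) auto
  also have "real N * (\<Sum>j\<in>I. 1 / real (u j)) = real N / real (u i) + (\<Sum>j\<in>I - {i}. real N / real (u j))"
    using fin i by (simp add: sum.remove distrib_left sum_distrib_left)
  finally have "real N / real (u i) \<in> \<int>"
    using others by (metis Ints_diff add_diff_cancel_right')
  then obtain z where "real N / real (u i) = of_int z"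
    by (elim Ints_cases)
  then have "real_of_int (int N) = real_of_int (z * int (u i))"
    using pos[OF i] by (simp add: field_simps)
  then have "int N = z * int (u i)"
    by (simp only: of_int_eq_iff)
  then have "int (u i) dvd int N"
    by simp
  then have "u i dvd N"
    by simp
  then have "q ^ f * q dvd q ^ f * (\<Prod>j\<in>I. w j)"
    using w(1)[OF i] vi by (metis N_def dvd_mult_left power_Suc2)
  then have "q dvd (\<Prod>j\<in>I. w j)"
    using q by (simp add: prime_gt_0_nat)
  then show False
    using prime_dvd_prod_iff[OF fin q] w(2) by blast
qed

lemma AP_common_prime_power_dvd_diff:
  fixes a d :: nat
  assumes "coprime a d" "prime q" "0 < e"
    and "q ^ e dvd a + i * d" "q ^ e dvd a + j * d"
  shows "q ^ e dvd j - i"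
proof -
  \<comment> \<open>Truncated subtraction: for \<open>j < i\<close> both sides are 0 and the claim
    is trivial.\<close>
  have "(a + j * d) - (a + i * d) = (j - i) * d"
    by (simp add: diff_mult_distrib)
  then have "q ^ e dvd (j - i) * d"
    using assms(4,5) by (metis dvd_diff_nat)
  moreover have "\<not> q dvd d"
  proof
    assume "q dvd d"
    have "q dvd q ^ e"
      using assms(3) by simp
    then have "q dvd a"
      using assms(4) \<open>q dvd d\<close> by (metis dvd_add_left_iff dvd_mult dvd_trans)
    with \<open>q dvd d\<close> show False
      using assms(1,2) by (metis coprime_common_divisor_nat not_prime_1)
  qed
  then have "coprime (q ^ e) d"
    using assms(2) by (simp add: prime_imp_coprime)
  ultimately show ?thesis
    by (simp add: coprime_dvd_mult_left_iff)
qed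

section \<open>Consequences of an integral reciprocal sum in the coprime case\<close>

context
  fixes a d k :: nat
  assumes a: "a > 0" and d: "d > 0" and k: "k > 0"
    and cop: "coprime a d"
    and int: "(\<Sum>j\<le>k. 1 / real (a + j * d)) \<in> \<int>"
begin

lemma obtain_two_multiples:
  assumes "prime q" "0 < e" "i \<le> k" "q ^ e dvd a + i * d"
  obtains j where "j \<le> k" "j \<noteq> i" "q ^ e dvd a + j * d"
  using prime_power_dvd_other_denominator[of "{..k}" "\<lambda>j. a + j * d" q e i] assms a int
  by auto

lemma term_dvd_Lcm:
  assumes "i \<le> k"
  shows "a + i * d dvd Lcm {1..k}"
proof (rule dvd_if_prime_powers_dvd)
  fix q e :: nat
  assume q: "prime q" "0 < e" "q ^ e dvd a + i * d"
  obtain j where j: "j \<le> k" "j \<noteq> i" "q ^ e dvd a + j * d"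
    using obtain_two_multiples q assms by blast
  \<comment> \<open>The order of \<open>i\<close> and \<open>j\<close> is unknown; the difference
    taken this way lies in \<open>{1..k}\<close>.\<close>
  have "q ^ e dvd max i j - min i j"
    using q j by (intro AP_common_prime_power_dvd_diff[OF cop q(1,2)]) (auto simp: max_def min_def)
  moreover have "max i j - min i j dvd Lcm {1..k}"
    using assms j by (intro dvd_Lcm) auto
  ultimately show "q ^ e dvd Lcm {1..k}"
    by (rule dvd_trans)
qed (use a in simp)

lemma difference_less_4: "d < 4"
proof (rule ccontr)
  assume "\<not> d < 4"
  have "a * (d ^ k * fact k) \<le> (\<Prod>j\<le>k. a + j * d)"
    by (rule prod_AP_ge)
  also have "\<dots> \<le> Lcm {1..k} * fact k"
    using prod_AP_dvd_coprime[OF cop term_dvd_Lcm] Lcm_upto_pos[of k] by (intro dvd_imp_le) auto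
  also have "\<dots> \<le> 4 ^ (k - 1) * fact k"
    using Lcm_upto_le[OF k] by simp
  finally have "a * d ^ k * fact k \<le> 4 ^ (k - 1) * fact k"
    by (simp add: mult.assoc)
  then have "a * d ^ k \<le> 4 ^ (k - 1)"
    using mult_le_cancel2[of _ "fact k" "4 ^ (k - 1) :: nat"] fact_gt_zero[of k, where 'a = nat]
    by blast
  moreover have "(4::nat) ^ (k - 1) < 4 ^ k"
    using k by (intro power_strict_increasing) auto
  moreover have "4 ^ k \<le> d ^ k"
    using \<open>\<not> d < 4\<close> by (intro power_mono) auto
  moreover have "d ^ k \<le> a * d ^ k"
    using a by simp
  ultimately show False
    by linarith
qed

text \<open>Let \<open>2 ^ e\<close> be the largest power of 2 dividing a term. It divides two
  terms, so their indices \<open>i < j\<close> are at least \<open>2 ^ e\<close> apart and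
  \<open>i + 2 ^ e\<close> is still an index. The term there is \<open>2 ^ e * (x + d)\<close> with
  \<open>x\<close> and \<open>d\<close> odd, contradicting maximality.\<close>

lemma even_difference: "even d"
proof (rule ccontr)
  assume odd: "odd d"
  define R where "R = (\<lambda>e. \<exists>i\<le>k. 2 ^ e dvd a + i * d)"
  have bound: "e \<le> a + k * d" if Re: "R e" for e
  proof -
    obtain i where "i \<le> k" "2 ^ e dvd a + i * d"
      using Re unfolding R_def by blast
    then have "2 ^ e \<le> a + i * d"
      using a by (intro dvd_imp_le) simp_all
    also have "\<dots> \<le> a + k * d"
      using \<open>i \<le> k\<close> by simp
    finally show ?thesis
      using less_exp[of e] by linarith
  qed
  \<comment> \<open>Makes the maximal exponent positive, as \<open>obtain_two_multiples\<close>
    requires.\<close>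
  have "2 ^ 1 dvd a + 0 * d \<or> 2 ^ 1 dvd a + 1 * d"
    using odd by auto
  then have R1: "R 1"
    unfolding R_def using k by (metis One_nat_def Suc_leI le0)
  define e where "e = (GREATEST e. R e)"
  have Re: "R e"
    unfolding e_def using R1 bound by (rule GreatestI_nat)
  have max: "e' \<le> e" if "R e'" for e'
    unfolding e_def using that bound by (rule Greatest_le_nat)
  have "e > 0"
    using max[OF R1] by simp
  obtain i0 where i0: "i0 \<le> k" "2 ^ e dvd a + i0 * d"
    using Re unfolding R_def by blast
  obtain j0 where j0: "j0 \<le> k" "j0 \<noteq> i0" "2 ^ e dvd a + j0 * d"
    using obtain_two_multiples[OF two_is_prime_nat \<open>e > 0\<close> i0] by blast
  obtain i j where ij: "i < j" "j \<le> k" "2 ^ e dvd a + i * d" "2 ^ e dvd a + j * d"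
    using i0 j0 by (metis nat_neq_iff)
  have "2 ^ e dvd j - i"
    using ij by (intro AP_common_prime_power_dvd_diff[OF cop two_is_prime_nat \<open>e > 0\<close>]) auto
  then have "2 ^ e \<le> j - i"
    using ij by (intro dvd_imp_le) auto
  then have le: "i + 2 ^ e \<le> k"
    using ij by simp
  obtain x where x: "a + i * d = 2 ^ e * x"
    using ij by (elim dvdE)
  have "odd x"
  proof
    assume "even x"
    then have "2 ^ e * 2 dvd 2 ^ e * x"
      by (rule mult_dvd_mono[OF dvd_refl])
    then have "2 ^ Suc e dvd a + i * d"
      unfolding x power_Suc2 .
    then have "R (Suc e)"
      unfolding R_def using ij by (meson le_trans less_imp_le)
    then show False
      using max by fastforce
  qed
  then have "2 ^ e * 2 dvd 2 ^ e * (x + d)"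
    using odd by (intro mult_dvd_mono[OF dvd_refl]) simp
  also have "2 ^ e * (x + d) = a + (i + 2 ^ e) * d"
    unfolding distrib_left x[symmetric] by (simp add: algebra_simps)
  finally have "R (Suc e)"
    unfolding R_def power_Suc2 using le by blast
  then show False
    using max by fastforce
qed

text \<open>A positive integral sum is at least 1, while each of its \<open>k + 1\<close> summands
  is at most \<open>1 / a\<close>.\<close>

lemma first_term_le: "a \<le> k + 1"
proof -
  define S where "S = (\<Sum>j\<le>k. 1 / real (a + j * d))"
  have "S > 0"
    unfolding S_def using a by (intro sum_pos) (auto intro: add_pos_nonneg)
  then have "1 \<le> S"
    using int unfolding S_def[symmetric] by (elim Ints_cases) simp
  also have "S \<le> (\<Sum>j\<le>k. 1 / real a)"
    unfolding S_def using a by (intro sum_mono) (simp add: frac_le)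
  also have "\<dots> = real (k + 1) / real a"
    by simp
  finally have "real a \<le> real (k + 1)"
    using a by (simp add: field_simps)
  then show ?thesis
    by (simp only: of_nat_le_iff)
qed

lemma difference_neq_2: "d \<noteq> 2"
proof
  assume d2: "d = 2"
  then have "odd a"
    using cop by simp
  have "Lcm {1..2 * k + 1} dvd 2 * Lcm {1..k}"
  proof (rule Lcm_least)
    fix m
    assume m: "m \<in> {1..2 * k + 1}"
    show "m dvd 2 * Lcm {1..k}"
    proof (rule dvd_if_prime_powers_dvd)
      fix q e :: nat
      assume q: "prime q" and e: "0 < e" and dvd: "q ^ e dvd m"
      have le: "q ^ e \<le> 2 * k + 1"
        using m dvd dvd_imp_le[of "q ^ e" m] by simp
      have pos: "q ^ i > 0" for i
        using q prime_gt_0_nat by simp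
      show "q ^ e dvd 2 * Lcm {1..k}"
      proof (cases "q ^ e \<le> k")
        case True
        then show ?thesis
          using pos[of e] by (intro dvd_mult dvd_Lcm) (simp add: Suc_le_eq)
      next
        case False
        show ?thesis
        proof (cases "q = 2")
          case True
          obtain e' where e': "e = Suc e'"
            using e gr0_implies_Suc by blast
          \<comment> \<open>Halving \<open>2 ^ e \<le> 2 * k + 1\<close> gives
            \<open>2 ^ e' \<le> k\<close>; the factor 2 in front of the lcm restores the lost
            one.\<close>
          have "q ^ e' dvd Lcm {1..k}"
            using pos[of e'] le True e' by (intro dvd_Lcm) (simp add: Suc_le_eq)
          then show ?thesis
            using True e' by simp
        next
          case 2: False
          then have "odd (q ^ e)"
            using q by (metis even_power primes_dvd_imp_eq two_is_prime_nat)
          \<comment> \<open>An odd prime power in \<open>{k + 1..2 * k + 1}\<close> has the parity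
            of \<open>a\<close> and is at least \<open>a\<close>, so it is itself a term of the
            progression.\<close>
          moreover have "a \<le> q ^ e"
            using first_term_le False by simp
          ultimately have "q ^ e = a + ((q ^ e - a) div 2) * d"
            using \<open>odd a\<close> d2 by simp
          moreover have "(q ^ e - a) div 2 \<le> k"
            using le a by linarith
          ultimately have "q ^ e dvd Lcm {1..k}"
            using term_dvd_Lcm by metis
          then show ?thesis
            by (rule dvd_mult)
        qed
      qed
    qed (use m in simp)
  qed
  then have "Lcm {1..2 * k + 1} \<le> 2 * Lcm {1..k}"
    using Lcm_upto_pos[of k] by (intro dvd_imp_le) auto
  also have "\<dots> \<le> 2 * 4 ^ (k - 1)"
    using Lcm_upto_le[OF k] by simp
  also have "\<dots> < 4 * 4 ^ (k - 1)"
    by simp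
  also have "\<dots> = 4 ^ k"
    using k by (simp flip: power_Suc)
  finally show False
    using Lcm_upto_ge[OF k] by simp
qed

end

text \<open>Dividing \<open>a\<close> and \<open>d\<close> by their gcd multiplies the sum by an
  integer, so the coprime case applies; no positive even number below 4 other than 2 is
  left.\<close>

theorem sum_inverse_AP_not_Ints:
  fixes a d k :: nat
  assumes "a > 0" "d > 0" "k > 0"
  shows "(\<Sum>j\<le>k. 1 / real (a + j * d)) \<notin> \<int>"
proof
  assume int: "(\<Sum>j\<le>k. 1 / real (a + j * d)) \<in> \<int>"
  define g where "g = gcd a d"
  have "g > 0"
    using assms by (simp add: g_def)
  then have "\<exists>a' d'. a = a' * g \<and> d = d' * g \<and> coprime a' d'"
    unfolding g_def by (intro gcd_coprime_exists) simp
  then obtain a' d' where ad: "a = a' * g" "d = d' * g" "coprime a' d'"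
    by blast
  have pos: "a' > 0" "d' > 0"
    using assms ad by auto
  have "(\<Sum>j\<le>k. 1 / real (a' + j * d')) = real g * (\<Sum>j\<le>k. 1 / real (a + j * d))"
    unfolding sum_distrib_left
  proof (rule sum.cong[OF refl])
    fix j
    have "a + j * d = g * (a' + j * d')"
      unfolding ad(1,2) by (simp add: algebra_simps)
    then show "1 / real (a' + j * d') = real g * (1 / real (a + j * d))"
      using \<open>g > 0\<close> by simp
  qed
  then have "(\<Sum>j\<le>k. 1 / real (a' + j * d')) \<in> \<int>"
    using int by simp
  note facts = pos assms(3) ad(3) this
  have "d' < 4" "even d'" "d' \<noteq> 2"
    using difference_less_4[OF facts] even_difference[OF facts] difference_neq_2[OF facts] by auto
  then have "d' = 0 \<or> d' = 1 \<or> d' = 3"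
    by presburger
  with \<open>even d'\<close> pos show False
    by auto
qed


text \<open>Division by the full product turns an equality into a reciprocal sum equal to
  \<open>p\<close>.\<close>

corollary sum_prod_AP_neq:
  fixes a d k p :: nat
  assumes "a > 0" "d > 0" "k > 0"
  shows "(\<Sum>i\<le>k. \<Prod>j\<in>{..k} - {i}. a + j * d) \<noteq> p * (\<Prod>j\<le>k. a + j * d)"
proof
  define P where "P = (\<Prod>j\<le>k. a + j * d)"
  assume "(\<Sum>i\<le>k. \<Prod>j\<in>{..k} - {i}. a + j * d) = p * (\<Prod>j\<le>k. a + j * d)"
  then have eq: "(\<Sum>i\<le>k. real (\<Prod>j\<in>{..k} - {i}. a + j * d)) = real p * real P"
    unfolding P_def by (simp only: flip: of_nat_mult of_nat_sum)
  have "P > 0"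
    unfolding P_def using assms by (intro prod_pos) auto
  then have "real P > 0"
    by simp
  have inverse: "1 / x = Q / R" if "R = x * Q" "R > 0" for x Q R :: real
    using that by auto
  have "(\<Sum>i\<le>k. 1 / real (a + i * d)) = (\<Sum>i\<le>k. real (\<Prod>j\<in>{..k} - {i}. a + j * d) / real P)"
  proof (rule sum.cong[OF refl])
    fix i
    assume "i \<in> {..k}"
    then have "P = (a + i * d) * (\<Prod>j\<in>{..k} - {i}. a + j * d)"
      unfolding P_def by (intro prod.remove) auto
    then have "real P = real (a + i * d) * real (\<Prod>j\<in>{..k} - {i}. a + j * d)"
      by (metis of_nat_mult)
    then show "1 / real (a + i * d) = real (\<Prod>j\<in>{..k} - {i}. a + j * d) / real P"
      using \<open>real P > 0\<close> by (rule inverse)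
  qed
  also have "\<dots> = real p"
    unfolding sum_divide_distrib[symmetric] eq using \<open>real P > 0\<close> by simp
  finally show False
    using sum_inverse_AP_not_Ints[OF assms] by (metis Ints_of_nat)
qed

section \<open>Models of \<open>PA\<^sup>-\<close>\<close>

locale PA_minus_model =
  fixes M :: "'a interp"
  assumes model: "is_model M PA_minus"
begin

abbreviation add (infixl "\<oplus>" 65) where "x \<oplus> y \<equiv> add_of M x y"
abbreviation mul (infixl "\<otimes>" 70) where "x \<otimes> y \<equiv> mul_of M x y"
abbreviation zero ("\<zero>") where "\<zero> \<equiv> zero_of M"
abbreviation one ("\<one>") where "\<one> \<equiv> one_of M"
abbreviation less (infix "\<prec>" 50) where "x \<prec> y \<equiv> less_of M x y"

definition le (infix "\<preceq>" 50) where "x \<preceq> y \<longleftrightarrow> x \<prec> y \<or> x = y"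

text \<open>The quantifiers are placed as simplification of the satisfied sentences leaves them, so
  that each fact is found by assumption.\<close>

lemma axioms:
  shows assoc [rule_format]: "\<forall>x y z. (x \<oplus> y) \<oplus> z = x \<oplus> (y \<oplus> z)"
    and comm [rule_format]: "\<forall>x y. x \<oplus> y = y \<oplus> x"
    and mul_assoc [rule_format]: "\<forall>x y z. (x \<otimes> y) \<otimes> z = x \<otimes> (y \<otimes> z)"
    and mul_comm [rule_format]: "\<forall>x y. x \<otimes> y = y \<otimes> x"
    and distrib [rule_format]: "\<forall>x y z. x \<otimes> (y \<oplus> z) = x \<otimes> y \<oplus> x \<otimes> z"
    and add_zero [rule_format]: "\<forall>x. x \<oplus> \<zero> = x"
    and mul_zero [rule_format]: "\<forall>x. x \<otimes> \<zero> = \<zero>"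
    and mul_one [rule_format]: "\<forall>x. x \<otimes> \<one> = x"
    and less_trans [rule_format]: "\<forall>x y z. x \<prec> y \<longrightarrow> y \<prec> z \<longrightarrow> x \<prec> z"
    and irrefl [rule_format]: "\<forall>x. \<not> x \<prec> x"
    and linear [rule_format]: "\<forall>x y. x \<prec> y \<or> x = y \<or> y \<prec> x"
    and add_mono [rule_format]: "\<forall>x y. x \<prec> y \<longrightarrow> (\<forall>z. x \<oplus> z \<prec> y \<oplus> z)"
    and mul_mono [rule_format]: "\<forall>x y z. \<zero> \<prec> z \<longrightarrow> x \<prec> y \<longrightarrow> x \<otimes> z \<prec> y \<otimes> z"
    and subtraction [rule_format]: "\<forall>x y. x \<prec> y \<longrightarrow> (\<exists>z. x \<oplus> z = y)"
    and zero_less_one: "\<zero> \<prec> \<one>"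
    and discrete [rule_format]: "\<forall>x. \<zero> \<prec> x \<longrightarrow> \<one> \<prec> x \<or> x = \<one>"
    and nonneg [rule_format]: "\<forall>x. \<zero> \<prec> x \<or> x = \<zero>"
  using model[unfolded is_model_def holds_in_def PA_minus_def Let_def, simplified,
    unfolded all_conj_distrib imp_conjL]
  by - (elim conjE, assumption)+

text \<open>Provides \<open>M.of_nat\<close>, \<open>M.sum_list\<close> and
  \<open>M.prod_list\<close>, hence standard elements and finite sums and products inside the
  model.\<close>

sublocale M: comm_semiring_1 "(\<otimes>)" "\<one>" "(\<oplus>)" "\<zero>"
proof
  show "\<zero> \<noteq> \<one>"
    using zero_less_one irrefl by metis
  show "(x \<oplus> y) \<otimes> z = x \<otimes> z \<oplus> y \<otimes> z" for x y z
    using distrib mul_comm by metis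
  show "\<zero> \<oplus> x = x" "\<zero> \<otimes> x = \<zero>" "\<one> \<otimes> x = x" for x
    using add_zero[of x] mul_zero[of x] mul_one[of x] comm[of x \<zero>] mul_comm[of x \<zero>]
      mul_comm[of x \<one>] by simp_all
  show "x \<oplus> y \<oplus> z = x \<oplus> (y \<oplus> z)" for x y z
    by (rule assoc)
  show "x \<oplus> y = y \<oplus> x" for x y
    by (rule comm)
  show "x \<otimes> y \<otimes> z = x \<otimes> (y \<otimes> z)" for x y z
    by (rule mul_assoc)
  show "x \<otimes> y = y \<otimes> x" for x y
    by (rule mul_comm)
  show "x \<otimes> \<zero> = \<zero>" for x
    by (rule mul_zero)
qed

sublocale le: linorder "(\<preceq>)" "(\<prec>)"
proof
  show "x \<prec> y \<longleftrightarrow> x \<preceq> y \<and> \<not> y \<preceq> x" for x y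
    using less_trans irrefl unfolding le_def by metis
  show "x \<preceq> x" for x
    unfolding le_def by simp
  show "x \<preceq> y \<Longrightarrow> y \<preceq> z \<Longrightarrow> x \<preceq> z" for x y z
    using less_trans unfolding le_def by metis
  show "x \<preceq> y \<Longrightarrow> y \<preceq> x \<Longrightarrow> x = y" for x y
    using less_trans irrefl unfolding le_def by metis
  show "x \<preceq> y \<or> y \<preceq> x" for x y
    using linear unfolding le_def by metis
qed


section \<open>Order and standard elements\<close>

lemma of_nat_less: "M.of_nat i \<prec> M.of_nat j" if "i < j"
  using that
proof (induction j)
  case (Suc j)
  have "M.of_nat j \<prec> M.of_nat (Suc j)"
    using add_mono[OF zero_less_one, of "M.of_nat j"] by simp
  then show ?case
    using Suc by (metis less_SucE less_trans)
qed simp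

lemma of_nat_inject: "M.of_nat i = M.of_nat j \<longleftrightarrow> i = j"
  using of_nat_less irrefl by (metis nat_neq_iff)

lemma zero_le: "\<zero> \<preceq> x"
  using nonneg by (auto simp: le_def)

lemma one_le: "\<one> \<preceq> x" if "\<zero> \<prec> x"
  using discrete that by (auto simp: le_def)

lemma add_le_mono: "x \<oplus> y \<preceq> x' \<oplus> y'" if "x \<preceq> x'" "y \<preceq> y'"
proof -
  have "a \<oplus> c \<preceq> b \<oplus> c" if "a \<preceq> b" for a b c
    using add_mono that by (auto simp: le_def)
  then show ?thesis
    using that le.order_trans comm by metis
qed

lemma le_add: "x \<preceq> x \<oplus> y"
  using add_le_mono[of x x \<zero> y] zero_le by simp

lemma mult_le_mono: "x \<otimes> z \<preceq> y \<otimes> z" if "x \<preceq> y"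
  using that mul_mono[of z x y] nonneg[of z] by (auto simp: le_def)

lemma mult_less_cancel: "x \<prec> y" if "x \<otimes> z \<prec> y \<otimes> z"
  using that mult_le_mono le.not_le by blast

lemma mult_le_cancel: "x \<preceq> y" if "\<zero> \<prec> z" "x \<otimes> z \<preceq> y \<otimes> z"
  using that mul_mono le.not_le by blast

lemma add_cancel: "x = y" if "z \<oplus> x = z \<oplus> y"
  using that add_mono[of x y z] add_mono[of y x z] linear[of x y] irrefl comm by metis

lemma mult_pos: "\<zero> \<prec> x \<otimes> y" if "\<zero> \<prec> x" "\<zero> \<prec> y"
  using mul_mono[of y \<zero> x] that by simp

lemma le_diffE:
  assumes "x \<preceq> y"
  obtains z where "y = x \<oplus> z"
  using assms subtraction[of x y] add_zero[of x] unfolding le_def by metis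

lemma add_le_cancel: "x \<preceq> y" if "z \<oplus> x \<preceq> z \<oplus> y"
  using that add_mono[of y x z] le.not_le[of x y] le.not_le comm by metis

text \<open>External induction on \<open>n\<close>: by discreteness a nonzero \<open>x\<close> is at
  least \<open>\<one>\<close>, and subtracting \<open>\<one>\<close> lowers the bound.\<close>

lemma le_of_natE:
  assumes "x \<preceq> M.of_nat n"
  obtains i where "x = M.of_nat i"
proof -
  have "\<exists>i. x = M.of_nat i"
    using assms
  proof (induction n arbitrary: x)
    case 0
    then show ?case
      using zero_le[of x] by (metis M.of_nat_0 le.order_antisym)
  next
    case (Suc n)
    show ?case
    proof (cases "x = \<zero>")
      case True
      then show ?thesis
        by (metis M.of_nat_0)
    next
      case False
      then obtain z where z: "x = \<one> \<oplus> z"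
        using nonneg one_le le_diffE by metis
      then have "z \<preceq> M.of_nat n"
        using Suc.prems add_le_cancel by simp
      then show ?thesis
        using Suc.IH z by (metis M.of_nat_Suc)
    qed
  qed
  then show ?thesis
    using that by blast
qed

section \<open>Finite sums and products in a model\<close>

text \<open>Replaces estimates of reciprocal sums: with \<open>f = Q\<close> and
  \<open>y = P\<close> below, the hypothesis says that \<open>c / u i\<close> is at most 1.\<close>

lemma sum_list_bound:
  assumes "\<And>x. x \<in> set xs \<Longrightarrow> c \<otimes> f x \<preceq> y"
  shows "c \<otimes> M.sum_list (map f xs) \<preceq> M.of_nat (length xs) \<otimes> y"
  using assms
proof (induction xs)
  case (Cons x xs)
  then have "c \<otimes> f x \<oplus> c \<otimes> M.sum_list (map f xs) \<preceq> y \<oplus> M.of_nat (length xs) \<otimes> y"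
    by (intro add_le_mono) auto
  then show ?case
    by (simp add: M.distrib_left M.distrib_right)
qed simp

lemma prod_list_pos:
  assumes "\<And>x. x \<in> set xs \<Longrightarrow> \<zero> \<prec> f x"
  shows "\<zero> \<prec> M.prod_list (map f xs)"
  using assms by (induction xs) (simp_all add: zero_less_one mult_pos)

lemma prod_list_remove:
  assumes "distinct xs" "i \<in> set xs"
  shows "f i \<otimes> M.prod_list (map f (filter (\<lambda>j. j \<noteq> i) xs)) = M.prod_list (map f xs)"
  using assms
proof (induction xs)
  case (Cons x xs)
  show ?case
  proof (cases "x = i")
    case True
    then have "filter (\<lambda>j. j \<noteq> i) xs = xs"
      using Cons.prems by (intro filter_True) auto
    then show ?thesis
      using True by simp
  next
    case False
    then show ?thesis
      using Cons by (simp add: M.mult.left_commute[of "f i" "f x"])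
  qed
qed simp

lemma of_nat_sum_list: "M.of_nat (sum_list (map f xs)) = M.sum_list (map (\<lambda>x. M.of_nat (f x)) xs)"
  by (induction xs) simp_all

lemma of_nat_prod_list: "M.of_nat (prod_list (map f xs)) = M.prod_list (map (\<lambda>x. M.of_nat (f x)) xs)"
  by (induction xs) simp_all

lemma eval_numeral_tm: "eval_tm M e (numeral_tm j) = M.of_nat j"
  by (induction j rule: numeral_tm.induct) (simp_all add: comm)

text \<open>Terms are bracketed to the left and list sums to the right; associativity with a general
  accumulator \<open>t\<close> reconciles them.\<close>

lemma eval_sum_tm: "eval_tm M e (sum_tm ts) = M.sum_list (map (eval_tm M e) ts)"
proof -
  have "eval_tm M e (foldl Add t ts) = eval_tm M e t \<oplus> M.sum_list (map (eval_tm M e) ts)" for t ts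
    by (induction ts arbitrary: t) (simp_all add: assoc)
  then show ?thesis
    by (cases ts) simp_all
qed

lemma eval_prod_tm: "eval_tm M e (prod_tm ts) = M.prod_list (map (eval_tm M e) ts)"
proof -
  have "eval_tm M e (foldl Mul t ts) = eval_tm M e t \<otimes> M.prod_list (map (eval_tm M e) ts)" for t ts
    by (induction ts arbitrary: t) (simp_all add: mul_assoc)
  then show ?thesis
    by (cases ts) simp_all
qed

section \<open>Every solution in a model is standard\<close>

context
  fixes k :: nat and m n p :: 'a and u :: "nat \<Rightarrow> 'a" and P :: 'a and Q :: "nat \<Rightarrow> 'a"
  assumes k: "k > 0" and m: "\<zero> \<prec> m" and n: "\<zero> \<prec> n"
  defines "u \<equiv> \<lambda>j. m \<oplus> M.of_nat j \<otimes> n"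
    and "P \<equiv> M.prod_list (map u [0..<Suc k])"
    and "Q \<equiv> \<lambda>i. M.prod_list (map u (filter (\<lambda>j. j \<noteq> i) [0..<Suc k]))"
  assumes eq: "M.sum_list (map Q [0..<Suc k]) = p \<otimes> P"
begin

lemma first_le_factor: "m \<preceq> u i"
  unfolding u_def by (rule le_add)

lemma factor_pos: "\<zero> \<prec> u i"
  using first_le_factor m le.less_le_trans by blast

lemma P_pos: "\<zero> \<prec> P"
  unfolding P_def by (rule prod_list_pos) (rule factor_pos)

lemma Q_pos: "\<zero> \<prec> Q i"
  unfolding Q_def by (rule prod_list_pos) (rule factor_pos)

text \<open>Without division, \<open>Q i\<close> stands for \<open>P / u i\<close>.\<close>

lemma factor_mult_Q: "u i \<otimes> Q i = P" if "i \<le> k"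
  unfolding P_def Q_def using that by (intro prod_list_remove) auto

lemma mult_Q_le: "c \<otimes> Q i \<preceq> P" if "i \<le> k" "c \<preceq> u i"
  using mult_le_mono[OF that(2), of "Q i"] factor_mult_Q[OF that(1)] by simp

lemma p_pos: "\<zero> \<prec> p"
proof (rule ccontr)
  assume "\<not> \<zero> \<prec> p"
  then have "p = \<zero>"
    using nonneg by blast
  have "Q 0 \<preceq> M.sum_list (map Q [0..<Suc k])"
    by (subst upt_conv_Cons) (simp_all add: le_add del: upt_Suc)
  then have "Q 0 \<preceq> \<zero>"
    unfolding eq using \<open>p = \<zero>\<close> by simp
  then show False
    using Q_pos[of 0] le.not_le by blast
qed

text \<open>\<open>p\<close> is a sum of \<open>k + 1\<close> reciprocals of elements that are at
  least \<open>\<one>\<close>.\<close>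

lemma p_le: "p \<preceq> M.of_nat (Suc k)"
proof (rule mult_le_cancel[OF P_pos])
  have "\<one> \<otimes> M.sum_list (map Q [0..<Suc k]) \<preceq> M.of_nat (length [0..<Suc k]) \<otimes> P"
  proof (rule sum_list_bound)
    fix i
    assume "i \<in> set [0..<Suc k]"
    then show "\<one> \<otimes> Q i \<preceq> P"
      using one_le[OF factor_pos] by (intro mult_Q_le) auto
  qed
  then show "p \<otimes> P \<preceq> M.of_nat (Suc k) \<otimes> P"
    by (simp only: eq M.mult_1_left length_upt minus_nat.diff_0)
qed

text \<open>Since \<open>p\<close> is at least \<open>\<one>\<close> and each reciprocal is at most
  \<open>1 / m\<close>, one has \<open>m \<preceq> m \<otimes> p\<close>, which is at most
  \<open>k + 1\<close>.\<close>

lemma m_le: "m \<preceq> M.of_nat (Suc k)"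
proof (rule mult_le_cancel[OF P_pos])
  have "\<one> \<otimes> (m \<otimes> P) \<preceq> p \<otimes> (m \<otimes> P)"
    using one_le[OF p_pos] by (rule mult_le_mono)
  also have "\<one> \<otimes> (m \<otimes> P) = m \<otimes> P"
    by simp
  also have "p \<otimes> (m \<otimes> P) = m \<otimes> M.sum_list (map Q [0..<Suc k])"
    unfolding eq by (rule M.mult.left_commute)
  also have "\<dots> \<preceq> M.of_nat (length [0..<Suc k]) \<otimes> P"
    by (rule sum_list_bound) (auto intro: mult_Q_le first_le_factor)
  finally show "m \<otimes> P \<preceq> M.of_nat (Suc k) \<otimes> P"
    by (simp only: length_upt minus_nat.diff_0)
qed

lemma n_le: "n \<preceq> M.of_nat k \<otimes> m"
proof -
  \<comment> \<open>Index 0 is split off because \<open>u 0 = m\<close> contains no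
    \<open>n\<close>; every later \<open>u i\<close> is at least \<open>n\<close>.\<close>
  define T where "T = M.sum_list (map Q [1..<Suc k])"
  have split: "p \<otimes> P = Q 0 \<oplus> T"
    unfolding eq[symmetric] T_def by (subst upt_conv_Cons) (simp_all del: upt_Suc)
  have "T = Q 1 \<oplus> M.sum_list (map Q [2..<Suc k])"
    unfolding T_def using k by (subst upt_conv_Cons) (simp_all add: numeral_2_eq_2 del: upt_Suc)
  then have T_pos: "\<zero> \<prec> T"
    using Q_pos[of 1] le_add le.less_le_trans by metis
  \<comment> \<open>Dividing by \<open>P\<close>: \<open>m p = 1 + m T / P\<close> with \<open>T > 0\<close>, so \<open>m T \<ge> P\<close> by discreteness,
     whereas \<open>n T \<le> k P\<close>.\<close>
  have mQ: "m \<otimes> Q 0 = P"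
    using factor_mult_Q[of 0] by (simp add: u_def)
  have mp: "(m \<otimes> p) \<otimes> P = P \<oplus> m \<otimes> T"
    unfolding mul_assoc split distrib mQ by (rule refl)
  have "\<one> \<otimes> P \<prec> (m \<otimes> p) \<otimes> P"
    unfolding mp using add_mono[OF mult_pos[OF m T_pos], of P] comm by simp
  then have "\<one> \<prec> m \<otimes> p"
    by (rule mult_less_cancel)
  then obtain z where z: "m \<otimes> p = \<one> \<oplus> z"
    using subtraction by metis
  have "z \<noteq> \<zero>"
    using \<open>\<one> \<prec> m \<otimes> p\<close> z irrefl by auto
  then have "\<one> \<preceq> z"
    using nonneg one_le by blast
  have "P \<oplus> m \<otimes> T = P \<oplus> z \<otimes> P"
    unfolding mp[symmetric] z by (simp add: M.distrib_right)
  then have "m \<otimes> T = z \<otimes> P"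
    by (rule add_cancel)
  then have "P \<preceq> m \<otimes> T"
    using mult_le_mono[OF \<open>\<one> \<preceq> z\<close>, of P] by simp
  have "n \<otimes> T \<preceq> M.of_nat (length [1..<Suc k]) \<otimes> P"
    unfolding T_def
  proof (rule sum_list_bound)
    fix i
    assume i: "i \<in> set [1..<Suc k]"
    then have "i > 0"
      by (simp del: upt_Suc)
    then obtain j where j: "i = Suc j"
      using gr0_implies_Suc by blast
    have "u i = n \<oplus> (m \<oplus> M.of_nat j \<otimes> n)"
      unfolding u_def j by (simp add: M.distrib_right M.add.left_commute)
    then have "n \<preceq> u i"
      using le_add by simp
    then show "n \<otimes> Q i \<preceq> P"
      using i by (intro mult_Q_le) auto
  qed
  also have "\<dots> = P \<otimes> M.of_nat k"
    by (simp add: mul_comm del: upt_Suc)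
  also have "P \<otimes> M.of_nat k \<preceq> (m \<otimes> T) \<otimes> M.of_nat k"
    using \<open>P \<preceq> m \<otimes> T\<close> by (rule mult_le_mono)
  also have "\<dots> = (M.of_nat k \<otimes> m) \<otimes> T"
    by (metis mul_assoc mul_comm)
  finally show ?thesis
    using T_pos mult_le_cancel by blast
qed

text \<open>\<open>m\<close> comes first: only once it is standard is \<open>k * m\<close> a
  standard bound for \<open>n\<close>.\<close>

lemma standard:
  obtains a b c where "m = M.of_nat a" "n = M.of_nat b" "p = M.of_nat c"
proof -
  obtain a where a: "m = M.of_nat a"
    using m_le le_of_natE by blast
  have "n \<preceq> M.of_nat (k * a)"
    using n_le a by simp
  then obtain b where b: "n = M.of_nat b"
    using le_of_natE by blast
  obtain c where "p = M.of_nat c"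
    using p_le le_of_natE by blast
  with a b show ?thesis
    using that by blast
qed

end

text \<open>A solution consists of standard elements, and the injective \<open>M.of_nat\<close>
  pulls the equation back to the natural numbers.\<close>

lemma sum_prod_list_neq:
  fixes m n p :: 'a
  defines "u \<equiv> \<lambda>j. m \<oplus> M.of_nat j \<otimes> n"
  assumes "k > 0" "\<zero> \<prec> m" "\<zero> \<prec> n"
  shows "M.sum_list (map (\<lambda>i. M.prod_list (map u (filter (\<lambda>j. j \<noteq> i) [0..<Suc k]))) [0..<Suc k])
    \<noteq> p \<otimes> M.prod_list (map u [0..<Suc k])"
proof
  assume eq: "M.sum_list (map (\<lambda>i. M.prod_list (map u (filter (\<lambda>j. j \<noteq> i) [0..<Suc k]))) [0..<Suc k])
    = p \<otimes> M.prod_list (map u [0..<Suc k])"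
  obtain a b c where abc: "m = M.of_nat a" "n = M.of_nat b" "p = M.of_nat c"
    using standard[OF assms(2-4) eq[unfolded u_def]] by blast
  have pos: "a > 0" "b > 0"
    using assms(3,4) irrefl unfolding abc by (metis M.of_nat_0 gr0I)+
  have u: "u = (\<lambda>j. M.of_nat (a + j * b))"
    unfolding u_def abc by simp
  define v where "v = (\<lambda>j. a + j * b)"
  have "sum_list (map (\<lambda>i. prod_list (map v (filter (\<lambda>j. j \<noteq> i) [0..<Suc k]))) [0..<Suc k])
      = c * prod_list (map v [0..<Suc k])"
    using eq unfolding u abc v_def
    by (simp only: of_nat_inject flip: of_nat_sum_list of_nat_prod_list M.of_nat_mult)
  moreover have "prod_list (map v (filter (\<lambda>j. j \<noteq> i) [0..<Suc k])) = (\<Prod>j\<in>{..k} - {i}. v j)" for i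
  proof -
    have "set (filter (\<lambda>j. j \<noteq> i) [0..<Suc k]) = {..k} - {i}"
      by (auto simp del: upt_Suc)
    then show ?thesis
      by (metis distinct_filter distinct_upt prod.distinct_set_conv_list)
  qed
  moreover have "set [0..<Suc k] = {..k}"
    by (auto simp del: upt_Suc)
  then have "sum_list (map f [0..<Suc k]) = (\<Sum>i\<le>k. f i)"
    "prod_list (map f [0..<Suc k]) = (\<Prod>i\<le>k. f i)" for f :: "nat \<Rightarrow> nat"
    by (metis distinct_upt sum.distinct_set_conv_list, metis distinct_upt prod.distinct_set_conv_list)
  ultimately have "(\<Sum>i\<le>k. \<Prod>j\<in>{..k} - {i}. v j) = c * (\<Prod>j\<le>k. v j)"
    by (simp del: upt_Suc)
  then show False
    using sum_prod_AP_neq[OF pos assms(2)] unfolding v_def by blast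
qed

end

text \<open>Brings the guarded list comprehension of \<open>nu\<close> into the
  \<open>filter\<close> form used for \<open>Q\<close>.\<close>

lemma concat_singletons_filter:
  "concat (map (\<lambda>x. if Q x then [f x] else []) xs) = map f (filter Q xs)"
  by (induction xs) auto

theorem mainTheorem2:
  fixes k :: nat and M :: "'a interp"
  assumes "k > 0"
    and "is_model M PA_minus"
  shows "M \<Turnstile> nu k"
proof -
  interpret PA_minus_model M
    by standard (fact assms(2))
  show ?thesis
    using sum_prod_list_neq[OF assms(1)]
    by (simp add: holds_in_def nu_def Let_def eval_sum_tm eval_prod_tm eval_numeral_tm
        concat_singletons_filter comp_def del: upt_Suc)
qed

end
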